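(* Let $\rho=\mathbb{P}_0\circ(X_0,X_1)^{-1}$ be the reference measure on $\mathbb{R}^d\times\mathbb{R}^d$, and assume that the Schr\"odinger bridge problem $\min_{\pi\in\Pi(\mu_0,\mu_1)}\mathbf{H}(\pi|\rho)$ has a unique solution $\pi^*\in\Pi_2(\mu_0,\mu_1)$. Then the probability measure $\widehat{\mathbb{P}}$ defined by $$\frac{d\widehat{\mathbb{P}}}{d\mathbb{P}_0}=\frac{d\pi^*}{d\rho}(X_0,X_1)$$ is the unique minimizer of $\mathbf{H}(\cdot|\mathbb{P}_0)$ on $\mathcal{P}_2(\mu_0,\mu_1)$.
   Context: $\Omega=C([0,1],\mathbb{R}^d)$ is the canonical space with canonical process $X$. $\mu_0,\mu_1$ are Borel probability measures on $\mathbb{R}^d$. $\mathbb{P}_0$ is the Wiener measure on $\Omega$ with initial distribution $\mu_0$: $\mathbb{P}_0\circ X_0^{-1}=\mu_0$ and $(X_t-X_0)_{t\in[0,1]}$ is a $\mathbb{P}_0$-Brownian motion independent of $X_0$. $\Pi(\mu_0,\mu_1)$ is the set of probability measures on $\mathbb{R}^d\times\mathbb{R}^d$ with first marginal $\mu_0$ and second marginal $\mu_1$, and $$\Pi_2(\mu_0,\mu_1)=\Big\{\pi\in\Pi(\mu_0,\mu_1):\ \mathbb{E}^{\mathbb{P}_0}\Big[\Big|\ln\Big(\frac{d\pi}{d\rho}(X_0,X_1)\Big)\Big|\Big]+\mathbb{E}^{\mathbb{P}_0}\Big[\Big(\frac{d\pi}{d\rho}(X_0,X_1)\Big)^2\Big]<\infty\Big\}$$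 (it is implicit that $\pi\ll\rho$, so that the density exists). $\mathcal{P}_2(\mu_0)$ is the set of Borel probability measures $\mathbb{P}$ on $\Omega$ equivalent to $\mathbb{P}_0$, with $\mathbb{P}\circ X_0^{-1}=\mu_0$, $\ln(\frac{d\mathbb{P}}{d\mathbb{P}_0})\in\mathbb{L}^1(\mathbb{P}_0)$ and $\frac{d\mathbb{P}}{d\mathbb{P}_0}\in\mathbb{L}^2(\mathbb{P}_0)$; and $\mathcal{P}_2(\mu_0,\mu_1)=\{\mathbb{P}\in\mathcal{P}_2(\mu_0):\mathbb{P}\circ X_1^{-1}=\mu_1\}$. For probability measures, $\mathbf{H}(\mathbb{Q}_1|\mathbb{Q}_0)=\mathbb{E}^{\mathbb{Q}_1}\big[\ln\frac{d\mathbb{Q}_1}{d\mathbb{Q}_0}\big]$ if $\mathbb{Q}_1\ll\mathbb{Q}_0$, and $\mathbf{H}(\mathbb{Q}_1|\mathbb{Q}_0)=\infty$ otherwise. *)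

theory Defs
  imports "HOL-Probability.Probability"
begin

text \<open>Elements of $C([0,1],\mathbb{R}^d)$ are represented by functions on the reals that take the
  value \<open>undefined\<close> outside $[0,1]$; the metric is the supremum distance.\<close>

definition path_metric :: "(real \<Rightarrow> real ^ 'd) metric" where
  "path_metric = cfunspace (top_of_set {0..1}) euclidean_metric"

definition path_space :: "(real \<Rightarrow> real ^ 'd) measure" where
  "path_space = sigma (mspace path_metric) {U. openin (mtopology_of path_metric) U}"

lemma space_path_space:
  "space (path_space :: (real \<Rightarrow> real ^ 'd) measure)
    = {\<omega>. \<omega> \<in> extensional {0..1} \<and> continuous_on {0..1} \<omega>}"
proof -
  have "space (path_space :: (real \<Rightarrow> real ^ 'd) measure) = mspace path_metric"
    unfolding path_space_def by (rule space_measure_of) (auto dest!: openin_subset simp: topspace_mtopology_of)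
  also have "\<dots> = {\<omega>. \<omega> \<in> extensional {0..1} \<and> continuous_on {0..1} \<omega>}"
    unfolding path_metric_def
    by (subst compactin_mspace_cfunspace) auto
  finally show ?thesis .
qed

lemma sets_path_space:
  "sets (path_space :: (real \<Rightarrow> real ^ 'd) measure)
    = sigma_sets (mspace path_metric) {U. openin (mtopology_of path_metric) U}"
  unfolding path_space_def
  by (rule sets_measure_of) (auto dest!: openin_subset simp: topspace_mtopology_of)

lemma eval_measurable_path_space:
  assumes t: "t \<in> {0..1}"
  shows "(\<lambda>\<omega>. \<omega> t) \<in> measurable (path_space :: (real \<Rightarrow> real ^ 'd) measure) borel"
proof (rule borel_measurableI)
  fix S :: "(real ^ 'd) set" assume S: "open S"
  let ?M = "path_metric :: (real \<Rightarrow> real ^ 'd) metric"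
  have sp: "space (path_space :: (real \<Rightarrow> real ^ 'd) measure) = mspace ?M"
    unfolding path_space_def by (rule space_measure_of) (auto dest!: openin_subset simp: topspace_mtopology_of)
  have "Lipschitz_continuous_map ?M euclidean_metric (\<lambda>\<omega>. \<omega> t)"
    unfolding Lipschitz_continuous_map_def
  proof (intro conjI exI[of _ 1] ballI)
    fix f g assume "f \<in> mspace ?M" "g \<in> mspace ?M"
    then show "mdist euclidean_metric (f t) (g t) \<le> 1 * mdist ?M f g"
      using mdist_cfunspace_imp_mdist_le[of f "top_of_set {0..1}" euclidean_metric g "mdist ?M f g" t] t
      unfolding path_metric_def by auto
  qed auto
  then have "continuous_map (mtopology_of ?M) (mtopology_of euclidean_metric) (\<lambda>\<omega>. \<omega> t)"
    using Lipschitz_continuous_imp_continuous_map by blast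
  then have "openin (mtopology_of ?M) {\<omega> \<in> mspace ?M. \<omega> t \<in> S}"
    using S by (auto simp: continuous_map_def)
  moreover have "(\<lambda>\<omega>. \<omega> t) -` S \<inter> space path_space = {\<omega> \<in> mspace ?M. \<omega> t \<in> S}"
    unfolding sp by auto
  ultimately show "(\<lambda>\<omega>. \<omega> t) -` S \<inter> space path_space \<in> sets path_space"
    unfolding sets_path_space by auto
qed

definition std_brownian_motion :: "'w measure \<Rightarrow> (real \<Rightarrow> 'w \<Rightarrow> real ^ 'd) \<Rightarrow> bool" where
  "std_brownian_motion M B \<longleftrightarrow>
     prob_space M \<and>
     (\<forall>t\<in>{0..1}. B t \<in> borel_measurable M) \<and>
     (AE \<omega> in M. B 0 \<omega> = 0) \<and>
     (AE \<omega> in M. continuous_on {0..1} (\<lambda>t. B t \<omega>)) \<and>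
     (\<forall>n (t :: nat \<Rightarrow> real). strict_mono_on {..n} t \<and> t ` {..n} \<subseteq> {0..1} \<longrightarrow>
        prob_space.indep_vars M (\<lambda>_. borel) (\<lambda>i \<omega>. B (t (Suc i)) \<omega> - B (t i) \<omega>) {..<n}) \<and>
     (\<forall>s t. 0 \<le> s \<and> s < t \<and> t \<le> 1 \<longrightarrow>
        distributed M lborel (\<lambda>\<omega>. B t \<omega> - B s \<omega>)
          (\<lambda>x. ennreal (\<Prod>i\<in>UNIV. normal_density 0 (sqrt (t - s)) (x $ i))))"

text \<open>Independence of $X_0$ and the process $(X_t - X_0)_{t \in [0,1]}$ is independence of the
  generated sigma-algebras.\<close>

definition wiener_measure :: "(real ^ 'd) measure \<Rightarrow> (real \<Rightarrow> real ^ 'd) measure \<Rightarrow> bool" where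
  "wiener_measure \<mu>0 P \<longleftrightarrow>
     prob_space P \<and> sets P = sets path_space \<and>
     distr P borel (\<lambda>\<omega>. \<omega> 0) = \<mu>0 \<and>
     std_brownian_motion P (\<lambda>t \<omega>. \<omega> t - \<omega> 0) \<and>
     prob_space.indep_set P
       (sets (vimage_algebra (space P) (\<lambda>\<omega>. \<omega> 0) borel))
       (sets (vimage_algebra (space P) (\<lambda>\<omega>. \<lambda>t\<in>{0..1}. \<omega> t - \<omega> 0)
          (\<Pi>\<^sub>M t\<in>{0..1}. borel)))"

definition endpoint_law ::
    "(real \<Rightarrow> real ^ 'd) measure \<Rightarrow> ((real ^ 'd) \<times> (real ^ 'd)) measure" where
  "endpoint_law P = distr P borel (\<lambda>\<omega>. (\<omega> 0, \<omega> 1))"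

text \<open>The expectation of $\ln (dQ_1/dQ_0)$ under $Q_1$ is an extended one: positive part minus
  negative part. The coercion \<open>ennreal\<close> truncates negative reals to 0. The density is
  positive and finite \<open>Q1\<close>-almost everywhere, so the values of \<open>ln\<close> and \<open>enn2real\<close> elsewhere do
  not matter. The negative part always has finite integral.\<close>

definition rel_entropy :: "'a measure \<Rightarrow> 'a measure \<Rightarrow> ereal" where
  "rel_entropy Q1 Q0 =
     (if absolutely_continuous Q0 Q1
      then enn2ereal (\<integral>\<^sup>+x. ennreal (ln (enn2real (RN_deriv Q0 Q1 x))) \<partial>Q1)
         - enn2ereal (\<integral>\<^sup>+x. ennreal (- ln (enn2real (RN_deriv Q0 Q1 x))) \<partial>Q1)
      else \<infinity>)"

text \<open>The extended value of $|\ln x|$. In contrast to the library's \<open>ln 0 = 0\<close>, it is infinite at 0,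
  so that its integrability forces a density to be positive almost everywhere.\<close>

definition abs_ln :: "ennreal \<Rightarrow> ennreal" where
  "abs_ln x = (if x = 0 \<or> x = \<infinity> then \<infinity> else ennreal \<bar>ln (enn2real x)\<bar>)"

definition couplings ::
    "(real ^ 'd) measure \<Rightarrow> (real ^ 'd) measure \<Rightarrow> ((real ^ 'd) \<times> (real ^ 'd)) measure set" where
  "couplings \<mu>0 \<mu>1 =
     {\<pi>. prob_space \<pi> \<and> sets \<pi> = sets borel \<and> distr \<pi> borel fst = \<mu>0 \<and> distr \<pi> borel snd = \<mu>1}"

definition couplings2 ::
    "(real \<Rightarrow> real ^ 'd) measure \<Rightarrow> (real ^ 'd) measure \<Rightarrow> (real ^ 'd) measure
      \<Rightarrow> ((real ^ 'd) \<times> (real ^ 'd)) measure set" where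
  "couplings2 P0 \<mu>0 \<mu>1 =
     {\<pi> \<in> couplings \<mu>0 \<mu>1. absolutely_continuous (endpoint_law P0) \<pi> \<and>
        (\<integral>\<^sup>+\<omega>. abs_ln (RN_deriv (endpoint_law P0) \<pi> (\<omega> 0, \<omega> 1)) \<partial>P0)
        + (\<integral>\<^sup>+\<omega>. (RN_deriv (endpoint_law P0) \<pi> (\<omega> 0, \<omega> 1))\<^sup>2 \<partial>P0) < \<infinity>}"

definition path_measures2 ::
    "(real \<Rightarrow> real ^ 'd) measure \<Rightarrow> (real ^ 'd) measure \<Rightarrow> (real \<Rightarrow> real ^ 'd) measure set" where
  "path_measures2 P0 \<mu>0 =
     {P. prob_space P \<and> sets P = sets path_space \<and>
        absolutely_continuous P0 P \<and> absolutely_continuous P P0 \<and>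
        distr P borel (\<lambda>\<omega>. \<omega> 0) = \<mu>0 \<and>
        integrable P0 (\<lambda>\<omega>. ln (enn2real (RN_deriv P0 P \<omega>))) \<and>
        integrable P0 (\<lambda>\<omega>. (enn2real (RN_deriv P0 P \<omega>))\<^sup>2)}"

definition bridge_measures2 ::
    "(real \<Rightarrow> real ^ 'd) measure \<Rightarrow> (real ^ 'd) measure \<Rightarrow> (real ^ 'd) measure
      \<Rightarrow> (real \<Rightarrow> real ^ 'd) measure set" where
  "bridge_measures2 P0 \<mu>0 \<mu>1 = {P \<in> path_measures2 P0 \<mu>0. distr P borel (\<lambda>\<omega>. \<omega> 1) = \<mu>1}"

definition unique_minimizer :: "('a \<Rightarrow> 'b::linorder) \<Rightarrow> 'a set \<Rightarrow> 'a \<Rightarrow> bool" where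
  "unique_minimizer f S x \<longleftrightarrow>
     is_arg_min f (\<lambda>y. y \<in> S) x \<and> (\<forall>y. is_arg_min f (\<lambda>y. y \<in> S) y \<longrightarrow> y = x)"

end

theory Submission
  imports Defs
begin

text \<open>Let \<open>T \<omega> = (\<omega> 0, \<omega> 1)\<close>. For \<open>P \<lless> P0\<close> with density \<open>g\<close>, let \<open>f\<close> be the density of the
  endpoint law \<open>\<pi>\<close> of \<open>P\<close> with respect to \<open>\<rho>\<close>. Integrating \<open>g ln (f \<circ> T) \<le> g ln g + f \<circ> T - g\<close>
  gives \<open>H(\<pi>|\<rho>) \<le> H(P|P0)\<close>, and equality of finite values forces \<open>g = f \<circ> T\<close>. The measure
  \<open>density P0 (d\<pi>'/d\<rho> \<circ> T)\<close> has endpoint law \<open>\<pi>'\<close> and attains equality, so its minimality and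
  uniqueness are inherited from those of \<open>\<pi>'\<close>.\<close>

section \<open>Pointwise bounds for the logarithm and Gibbs' inequality\<close>

text \<open>This is \<open>ln y \<le> y - 1\<close> at \<open>y = 1 / x\<close>, multiplied by
  \<open>x\<close>. A bound uniform in \<open>x\<close> keeps the negative part of an entropy finite
  on a probability space.\<close>

lemma neg_mult_ln_le_1: "- (x * ln x) \<le> 1" if "0 \<le> x" for x :: real
proof (cases "x = 0")
  case False
  then have "ln (1 / x) \<le> 1 / x - 1"
    using that by (intro ln_le_minus_one) auto
  then have "x * (- ln x) \<le> x * (1 / x - 1)"
    using that False by (intro mult_left_mono) (auto simp: ln_div)
  then show ?thesis
    using that False by (simp add: algebra_simps)
qed simp

text \<open>Multiply \<open>ln y \<le> y - 1\<close> at \<open>y = f / g\<close> by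
  \<open>g\<close>; equality there holds only at \<open>y = 1\<close>. For \<open>g = 0\<close> both
  logarithmic terms vanish and what remains is \<open>0 \<le> f\<close>, respectively
  \<open>0 = f\<close>.\<close>

lemma mult_ln_le:
  fixes f g :: real
  assumes "0 \<le> f" "0 \<le> g" "0 < g \<Longrightarrow> 0 < f"
  shows "g * ln f \<le> g * ln g + f - g"
    and "g * ln f = g * ln g + f - g \<Longrightarrow> f = g"
proof -
  have *: "g * ln f - g * ln g = g * ln (f / g) \<and> g * (f / g - 1) = f - g" if "0 < g"
    using assms that by (simp add: ln_div algebra_simps)
  show "g * ln f \<le> g * ln g + f - g"
  proof (cases "g = 0")
    case False
    with assms have pos: "0 < g" "0 < f" by auto
    have "g * ln (f / g) \<le> g * (f / g - 1)"
      using pos by (intro mult_left_mono ln_le_minus_one) auto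
    with * pos show ?thesis by linarith
  qed (use assms in auto)
  show "f = g" if eq: "g * ln f = g * ln g + f - g"
  proof (cases "g = 0")
    case False
    with assms have pos: "0 < g" "0 < f" by auto
    with * eq have "g * ln (f / g) = g * (f / g - 1)" by linarith
    with pos have "ln (f / g) = f / g - 1" by simp
    with pos have "f / g = 1" by (intro ln_eq_minus_one) auto
    with pos show ?thesis by simp
  qed (use eq in simp)
qed

text \<open>Integrate the pointwise bound; the terms \<open>f - g\<close> cancel because the
  integrals agree. The positivity assumption encodes absolute continuity of the measure with density
  \<open>g\<close> with respect to the one with density \<open>f\<close>.\<close>

lemma gibbs_inequality:
  fixes f g :: "'a \<Rightarrow> real"
  assumes nonneg: "\<And>x. 0 \<le> f x" "\<And>x. 0 \<le> g x"
    and pos: "AE x in M. 0 < g x \<longrightarrow> 0 < f x"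
    and int: "integrable M f" "integrable M g" "integrable M (\<lambda>x. g x * ln (g x))"
    and eq: "integral\<^sup>L M f = integral\<^sup>L M g"
    and neg: "(\<integral>\<^sup>+x. ennreal (- (g x * ln (f x))) \<partial>M) < \<infinity>"
  shows "integrable M (\<lambda>x. g x * ln (f x))"
    and "(\<integral>x. g x * ln (f x) \<partial>M) \<le> (\<integral>x. g x * ln (g x) \<partial>M)"
    and "(\<integral>x. g x * ln (f x) \<partial>M) = (\<integral>x. g x * ln (g x) \<partial>M) \<Longrightarrow> AE x in M. f x = g x"
proof -
  have [measurable]: "f \<in> borel_measurable M" "g \<in> borel_measurable M"
    using int by auto
  have le: "AE x in M. g x * ln (f x) \<le> g x * ln (g x) + f x - g x"
    using pos by eventually_elim (rule mult_ln_le(1), auto simp: nonneg)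
  have "(\<integral>\<^sup>+x. ennreal (max 0 (- (g x * ln (f x)))) \<partial>M) = (\<integral>\<^sup>+x. ennreal (- (g x * ln (f x))) \<partial>M)"
    by (rule nn_integral_cong) (simp add: max_def ennreal_neg)
  with neg have "integrable M (\<lambda>x. max 0 (- (g x * ln (f x))))"
    by (intro integrableI_nonneg) auto
  \<comment> \<open>A dominating function for \<open>g ln f\<close>: the pointwise bound controls it
    from above, the hypothesis \<open>neg\<close> from below.\<close>
  then have "integrable M (\<lambda>x. \<bar>g x * ln (g x) + f x - g x\<bar> + max 0 (- (g x * ln (f x))))"
    using int by (intro Bochner_Integration.integrable_add integrable_abs Bochner_Integration.integrable_diff)
  then show int_f: "integrable M (\<lambda>x. g x * ln (f x))"
    by (rule Bochner_Integration.integrable_bound) (use le in auto)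
  \<comment> \<open>The gap in the pointwise bound: it is nonnegative a.e. and its integral is the
    difference of the two logarithmic integrals, so equality of these makes it vanish a.e.\<close>
  let ?h = "\<lambda>x. g x * ln (g x) + f x - g x - g x * ln (f x)"
  have int_h: "integrable M ?h"
    using int int_f by auto
  have h: "integral\<^sup>L M ?h = (\<integral>x. g x * ln (g x) \<partial>M) - (\<integral>x. g x * ln (f x) \<partial>M)"
    using int int_f eq by simp
  have nonneg_h: "AE x in M. 0 \<le> ?h x"
    using le by eventually_elim simp
  then have "0 \<le> integral\<^sup>L M ?h"
    by (rule integral_nonneg_AE)
  with h show "(\<integral>x. g x * ln (f x) \<partial>M) \<le> (\<integral>x. g x * ln (g x) \<partial>M)"
    by simp
  assume "(\<integral>x. g x * ln (f x) \<partial>M) = (\<integral>x. g x * ln (g x) \<partial>M)"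
  with h have "integral\<^sup>L M ?h = 0" by simp
  then have "AE x in M. ?h x = 0"
    using integral_nonneg_eq_0_iff_AE[OF int_h nonneg_h] by blast
  with pos show "AE x in M. f x = g x"
    by eventually_elim (rule mult_ln_le(2), auto simp: nonneg)
qed

section \<open>Relative entropy in terms of real densities\<close>

text \<open>Finiteness of \<open>N\<close> makes its density finite a.e., so a real-valued version
  exists, to which \<open>ln\<close> and Bochner integration apply.\<close>

lemma (in prob_space) ex_real_density:
  assumes "prob_space N" "absolutely_continuous M N" "sets N = sets M"
  obtains f :: "'a \<Rightarrow> real" where "f \<in> borel_measurable M" "\<And>x. 0 \<le> f x"
    "AE x in M. RN_deriv M N x = ennreal (f x)" "N = density M (\<lambda>x. ennreal (f x))"
proof -
  interpret N: prob_space N by fact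
  obtain f where f: "f \<in> borel_measurable M" "AE x in M. RN_deriv M N x = ennreal (f x)"
    "\<And>x. 0 \<le> f x"
    using real_RN_deriv[OF N.finite_measure_axioms assms(2,3)] by metis
  have "N = density M (RN_deriv M N)"
    using density_RN_deriv[OF assms(2,3)] by simp
  also have "\<dots> = density M (\<lambda>x. ennreal (f x))"
    using f by (intro density_cong) auto
  finally show ?thesis
    using that f by blast
qed

lemma (in prob_space) nn_integral_neg_mult_ln_le_1:
  assumes "\<And>x. 0 \<le> f x"
  shows "(\<integral>\<^sup>+x. ennreal (- (f x * ln (f x))) \<partial>M) \<le> 1"
proof -
  have "(\<integral>\<^sup>+x. ennreal (- (f x * ln (f x))) \<partial>M) \<le> (\<integral>\<^sup>+x. 1 \<partial>M)"
    using neg_mult_ln_le_1[OF assms] by (intro nn_integral_mono) simp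
  then show ?thesis by (simp add: emeasure_space_1)
qed

lemma (in prob_space) RN_deriv_density:
  assumes [measurable]: "f \<in> borel_measurable M"
  shows "AE x in M. RN_deriv M (density M f) x = f x"
  using RN_deriv_unique[of f "density M f"] by auto

lemma (in prob_space) rel_entropy_density:
  fixes f :: "'a \<Rightarrow> real"
  assumes [measurable]: "f \<in> borel_measurable M" and nonneg: "\<And>x. 0 \<le> f x"
  shows "rel_entropy (density M f) M
    = enn2ereal (\<integral>\<^sup>+x. ennreal (f x * ln (f x)) \<partial>M) - enn2ereal (\<integral>\<^sup>+x. ennreal (- (f x * ln (f x))) \<partial>M)"
proof -
  let ?N = "density M f"
  have ac: "absolutely_continuous M ?N"
    by (simp add: absolutely_continuousI_density)
  have RN: "AE x in M. RN_deriv M ?N x = ennreal (f x)"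
    by (rule RN_deriv_density) simp
  \<comment> \<open>The values \<open>c = 1\<close> and \<open>c = -1\<close> give the positive and
    the negative part. The weight \<open>f x\<close> is nonnegative, so it passes through the
    truncation \<open>ennreal\<close>.\<close>
  have *: "(\<integral>\<^sup>+x. ennreal (c * ln (enn2real (RN_deriv M ?N x))) \<partial>?N)
    = (\<integral>\<^sup>+x. ennreal (c * (f x * ln (f x))) \<partial>M)" for c :: real
  proof -
    have "(\<integral>\<^sup>+x. ennreal (c * ln (enn2real (RN_deriv M ?N x))) \<partial>?N)
      = (\<integral>\<^sup>+x. ennreal (f x) * ennreal (c * ln (enn2real (RN_deriv M ?N x))) \<partial>M)"
      by (rule nn_integral_density) auto
    also have "\<dots> = (\<integral>\<^sup>+x. ennreal (c * (f x * ln (f x))) \<partial>M)"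
      by (rule nn_integral_cong_AE, use RN in eventually_elim)
        (simp add: nonneg ennreal_mult'[symmetric] mult_ac)
    finally show ?thesis .
  qed
  show ?thesis
    unfolding rel_entropy_def using ac *[of 1] *[of "-1"] by simp
qed

text \<open>The negative part is at most 1, so the positive part alone decides finiteness and no
  difference of infinities arises.\<close>

lemma (in prob_space) rel_entropy_density_finite:
  fixes f :: "'a \<Rightarrow> real"
  assumes [measurable]: "f \<in> borel_measurable M" and nonneg: "\<And>x. 0 \<le> f x"
  shows "rel_entropy (density M f) M < \<infinity> \<longleftrightarrow> integrable M (\<lambda>x. f x * ln (f x))" (is "?A \<longleftrightarrow> ?B")
    and "integrable M (\<lambda>x. f x * ln (f x)) \<Longrightarrow>
      rel_entropy (density M f) M = ereal (\<integral>x. f x * ln (f x) \<partial>M)"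
proof -
  let ?p = "\<integral>\<^sup>+x. ennreal (f x * ln (f x)) \<partial>M" and ?n = "\<integral>\<^sup>+x. ennreal (- (f x * ln (f x))) \<partial>M"
  have n: "?n < \<infinity>"
    using nn_integral_neg_mult_ln_le_1[of f, OF nonneg] by (auto intro: le_less_trans)
  have "?B \<longleftrightarrow> ?p < \<infinity>"
    using n by (auto simp: real_integrable_def top.not_eq_extremum)
  also have "\<dots> \<longleftrightarrow> ?A"
    unfolding rel_entropy_density[of f, OF assms] using n
    by (cases ?p rule: ennreal_cases; cases ?n rule: ennreal_cases) auto
  finally show "?A \<longleftrightarrow> ?B" by simp
  assume B: ?B
  then have "?p < \<infinity>"
    using \<open>?B \<longleftrightarrow> ?p < \<infinity>\<close> by simp
  then show "rel_entropy (density M f) M = ereal (\<integral>x. f x * ln (f x) \<partial>M)"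
    unfolding rel_entropy_density[of f, OF assms] real_lebesgue_integral_def[OF B] using n
    by (cases ?p rule: ennreal_cases; cases ?n rule: ennreal_cases) auto
qed

text \<open>For \<open>x > 0\<close>, \<open>ln x \<le> x\<close> gives
  \<open>x ln x \<le> x^2\<close>, while \<open>x ln x\<close> is at least -1; hence
  \<open>1 + x^2\<close> dominates its absolute value. This makes the entropy finite on
  \<open>bridge_measures2\<close>.\<close>

lemma (in prob_space) rel_entropy_finite_of_square_integrable:
  fixes f :: "'a \<Rightarrow> real"
  assumes [measurable]: "f \<in> borel_measurable M" and nonneg: "\<And>x. 0 \<le> f x"
    and sq: "integrable M (\<lambda>x. (f x)\<^sup>2)"
  shows "rel_entropy (density M f) M < \<infinity>"
proof -
  have le: "\<bar>f x * ln (f x)\<bar> \<le> 1 + (f x)\<^sup>2" for x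
  proof -
    have "f x * ln (f x) \<le> f x * f x"
    proof (cases "f x = 0")
      case False
      with nonneg[of x] show ?thesis
        by (intro mult_left_mono ln_bound) auto
    qed simp
    moreover have "0 \<le> f x * f x" by simp
    ultimately show ?thesis
      using neg_mult_ln_le_1[OF nonneg, of x] unfolding power2_eq_square by linarith
  qed
  have "integrable M (\<lambda>x. 1 + (f x)\<^sup>2)"
    using sq by simp
  then have "integrable M (\<lambda>x. f x * ln (f x))"
    by (rule Bochner_Integration.integrable_bound) (simp_all add: le del: abs_mult)
  then show ?thesis
    using rel_entropy_density_finite(1)[of f] nonneg by simp
qed

section \<open>Relative entropy under push-forward\<close>

text \<open>Change of variables along \<open>T\<close> identifies both parts of the entropy. A
  density that factors through \<open>T\<close> thus loses no entropy under
  \<open>T\<close>.\<close>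

lemma (in prob_space) rel_entropy_density_comp:
  assumes [measurable]: "T \<in> measurable M N" "f \<in> borel_measurable N" and nonneg: "\<And>x. 0 \<le> f x"
  shows "rel_entropy (density M (\<lambda>x. ennreal (f (T x)))) M
    = rel_entropy (density (distr M N T) (\<lambda>y. ennreal (f y))) (distr M N T)"
proof -
  interpret N: prob_space "distr M N T" by (rule prob_space_distr) simp
  show ?thesis
    using nonneg by (simp add: rel_entropy_density N.rel_entropy_density nn_integral_distr)
qed

lemma absolutely_continuous_distr:
  assumes ac: "absolutely_continuous M P" and sets: "sets P = sets M"
    and T: "T \<in> measurable M N"
  shows "absolutely_continuous (distr M N T) (distr P N T)"
proof -
  have T': "T \<in> measurable P N"
    using T measurable_cong_sets[OF sets refl] by blast
  show ?thesis
    unfolding absolutely_continuous_def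
  proof
    fix A assume "A \<in> null_sets (distr M N T)"
    then have A: "A \<in> sets N" "T -` A \<inter> space M \<in> null_sets M"
      using T by (simp_all add: null_sets_distr_iff)
    have "T -` A \<inter> space P \<in> null_sets P"
      using A(2) ac sets_eq_imp_space_eq[OF sets] by (auto simp: absolutely_continuous_def)
    with A(1) T' show "A \<in> null_sets (distr P N T)"
      by (simp add: null_sets_distr_iff)
  qed
qed

text \<open>The data-processing inequality with its equality case: Gibbs' inequality for the density
  \<open>g\<close> of \<open>P\<close> and the composition of the density of \<pi> with
  \<open>T\<close>. Finiteness is assumed for the equality case since infinite values carry no
  information on the densities.\<close>

lemma (in prob_space) rel_entropy_distr:
  assumes P: "prob_space P" "absolutely_continuous M P" "sets P = sets M"
    and T[measurable]: "T \<in> measurable M N"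
  defines "\<rho> \<equiv> distr M N T" and "\<pi> \<equiv> distr P N T"
  shows "rel_entropy \<pi> \<rho> \<le> rel_entropy P M"
    and "rel_entropy P M < \<infinity> \<Longrightarrow> rel_entropy \<pi> \<rho> = rel_entropy P M \<Longrightarrow>
      density M (\<lambda>x. RN_deriv \<rho> \<pi> (T x)) = P"
proof -
  interpret P: prob_space P by fact
  have T'[measurable]: "T \<in> measurable P N"
    using T measurable_cong_sets[OF P(3) refl] by blast
  interpret rho: prob_space \<rho> unfolding \<rho>_def by (rule prob_space_distr) simp
  interpret pi: prob_space \<pi> unfolding \<pi>_def by (rule P.prob_space_distr) simp
  have ac: "absolutely_continuous \<rho> \<pi>"
    unfolding \<rho>_def \<pi>_def by (rule absolutely_continuous_distr) fact+
  obtain g where g[measurable]: "g \<in> borel_measurable M" and g0: "\<And>x. 0 \<le> g x"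
    and P_eq: "P = density M (\<lambda>x. ennreal (g x))"
    using ex_real_density[OF P] by blast
  obtain f where f: "f \<in> borel_measurable \<rho>" and f0: "\<And>x. 0 \<le> f x"
    and RN: "AE x in \<rho>. RN_deriv \<rho> \<pi> x = ennreal (f x)" and pi_eq: "\<pi> = density \<rho> (\<lambda>x. ennreal (f x))"
    using rho.ex_real_density[OF pi.prob_space_axioms ac] by (auto simp: \<rho>_def \<pi>_def)
  have [measurable]: "f \<in> borel_measurable N"
    using f by (simp add: \<rho>_def)
  have nn_integral_1: "(\<integral>\<^sup>+x. ennreal (g x) \<partial>M) = 1" "(\<integral>\<^sup>+x. ennreal (f (T x)) \<partial>M) = 1"
    using P.emeasure_space_1 pi.emeasure_space_1 unfolding P_eq pi_eq \<rho>_def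
    by (simp_all add: emeasure_density nn_integral_distr measurable_space[OF T] cong: nn_integral_cong)
  have int: "integrable M g" "integrable M (\<lambda>x. f (T x))"
    using nn_integral_1 f0 g0 by (auto intro!: integrableI_nonneg)
  have int_eq: "(\<integral>x. f (T x) \<partial>M) = integral\<^sup>L M g"
    using nn_integral_1 f0 g0 by (simp add: integral_eq_nn_integral)
  \<comment> \<open>A density is positive a.e. under the measure it defines. Pulled back to
    \<open>P\<close>, this is the positivity condition of Gibbs' inequality.\<close>
  have "AE y in \<pi>. 0 < f y"
    unfolding pi_eq using f by (simp add: AE_density)
  then have "AE x in P. 0 < f (T x)"
    unfolding \<pi>_def by (rule AE_distrD[OF T'])
  then have pos: "AE x in M. 0 < g x \<longrightarrow> 0 < f (T x)"
    unfolding P_eq by (simp add: AE_density)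
  \<comment> \<open>The logarithm depends on \<open>x\<close> only through \<open>T x\<close>, so
    the integral moves from \<open>M\<close> to \<open>P\<close>, along \<open>T\<close> to \<pi>,
    and from there to \<rho>, where the weight \<open>g\<close> has become \<open>f\<close>.\<close>
  have transfer: "(\<integral>\<^sup>+x. ennreal (c * (g x * ln (f (T x)))) \<partial>M)
    = (\<integral>\<^sup>+y. ennreal (c * (f y * ln (f y))) \<partial>\<rho>)" for c :: real
  proof -
    have "(\<integral>\<^sup>+x. ennreal (c * (g x * ln (f (T x)))) \<partial>M) = (\<integral>\<^sup>+x. ennreal (c * ln (f (T x))) \<partial>P)"
      unfolding P_eq by (subst nn_integral_density) (auto simp: g0 ennreal_mult'[symmetric] mult_ac)
    also have "\<dots> = (\<integral>\<^sup>+y. ennreal (c * ln (f y)) \<partial>\<pi>)"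
      unfolding \<pi>_def by (rule nn_integral_distr[symmetric]) auto
    also have "\<dots> = (\<integral>\<^sup>+y. ennreal (c * (f y * ln (f y))) \<partial>\<rho>)"
      unfolding pi_eq using f by (subst nn_integral_density) (auto simp: f0 ennreal_mult'[symmetric] mult_ac)
    finally show ?thesis .
  qed
  have neg: "(\<integral>\<^sup>+x. ennreal (- (g x * ln (f (T x)))) \<partial>M) < \<infinity>"
    using transfer[of "-1"] rho.nn_integral_neg_mult_ln_le_1[of f, OF f0]
    by (auto intro: le_less_trans)
  have main: "rel_entropy \<pi> \<rho> \<le> rel_entropy P M \<and>
    (rel_entropy \<pi> \<rho> = rel_entropy P M \<longrightarrow> (AE x in M. f (T x) = g x))" if fin: "rel_entropy P M < \<infinity>"
  proof -
    have int_g: "integrable M (\<lambda>x. g x * ln (g x))"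
      using fin rel_entropy_density_finite(1)[of g] g0 unfolding P_eq by simp
    note gibbs = gibbs_inequality[of "\<lambda>x. f (T x)" g M, OF f0 g0 pos int(2,1) int_g int_eq neg]
    have int_f: "integrable \<rho> (\<lambda>y. f y * ln (f y))"
      using gibbs(1) transfer[of 1] transfer[of "-1"] f by (simp add: real_integrable_def)
    have "(\<integral>y. f y * ln (f y) \<partial>\<rho>) = (\<integral>x. g x * ln (f (T x)) \<partial>M)"
      using transfer[of 1] transfer[of "-1"]
      by (simp add: real_lebesgue_integral_def[OF int_f] real_lebesgue_integral_def[OF gibbs(1)])
    then have "rel_entropy \<pi> \<rho> = ereal (\<integral>x. g x * ln (f (T x)) \<partial>M)"
      unfolding pi_eq using rho.rel_entropy_density_finite(2)[OF f f0 int_f] by simp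
    moreover have "rel_entropy P M = ereal (\<integral>x. g x * ln (g x) \<partial>M)"
      unfolding P_eq using rel_entropy_density_finite(2)[OF g g0 int_g] by simp
    ultimately show ?thesis
      using gibbs(2,3) by simp
  qed
  then show "rel_entropy \<pi> \<rho> \<le> rel_entropy P M"
    by (cases "rel_entropy P M < \<infinity>") auto
  assume "rel_entropy P M < \<infinity>" "rel_entropy \<pi> \<rho> = rel_entropy P M"
  with main have "AE x in M. f (T x) = g x" by blast
  \<comment> \<open>The chosen \<open>f\<close> is only a \<rho>-a.e. version of the Radon-Nikodym
    derivative; \<rho>-null sets pull back along \<open>T\<close> to \<open>M\<close>-null
    sets.\<close>
  moreover have "AE x in M. RN_deriv \<rho> \<pi> (T x) = ennreal (f (T x))"
    by (rule AE_distrD[OF T RN[unfolded \<rho>_def], folded \<rho>_def])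
  ultimately have "AE x in M. RN_deriv \<rho> \<pi> (T x) = ennreal (g x)"
    by eventually_elim simp
  moreover have [measurable]: "RN_deriv \<rho> \<pi> \<in> borel_measurable N"
    using borel_measurable_RN_deriv[of \<rho> \<pi>] by (simp add: \<rho>_def)
  ultimately show "density M (\<lambda>x. RN_deriv \<rho> \<pi> (T x)) = P"
    unfolding P_eq by (intro density_cong) auto
qed

theorem corollary2p8:
  fixes \<mu>0 \<mu>1 :: "(real ^ 'd) measure"
    and P0 :: "(real \<Rightarrow> real ^ 'd) measure"
    and \<rho> \<pi>' :: "((real ^ 'd) \<times> (real ^ 'd)) measure"
  assumes "prob_space \<mu>0" and "sets \<mu>0 = sets borel"
    and "prob_space \<mu>1" and "sets \<mu>1 = sets borel"
    and "wiener_measure \<mu>0 P0"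
    and "\<rho> = endpoint_law P0"
    and "unique_minimizer (\<lambda>\<pi>. rel_entropy \<pi> \<rho>) (couplings \<mu>0 \<mu>1) \<pi>'"
    and "\<pi>' \<in> couplings2 P0 \<mu>0 \<mu>1"
  shows "unique_minimizer (\<lambda>P. rel_entropy P P0) (bridge_measures2 P0 \<mu>0 \<mu>1)
           (density P0 (\<lambda>\<omega>. RN_deriv \<rho> \<pi>' (\<omega> 0, \<omega> 1)))"
proof -

  \<comment> \<open>The endpoint map and its marginals\<close>
  define T :: "(real \<Rightarrow> real ^ 'd) \<Rightarrow> (real ^ 'd) \<times> (real ^ 'd)" where "T \<omega> = (\<omega> 0, \<omega> 1)" for \<omega>
  interpret P0: prob_space P0
    using assms(5) by (simp add: wiener_measure_def)
  have sets_P0: "sets P0 = sets path_space"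
    using assms(5) by (simp add: wiener_measure_def)
  have eval: "(\<lambda>\<omega>. \<omega> 0) \<in> measurable P borel" "(\<lambda>\<omega>. \<omega> 1) \<in> measurable P borel"
    if "sets P = sets (path_space :: (real \<Rightarrow> real ^ 'd) measure)" for P
    using eval_measurable_path_space[of 0] eval_measurable_path_space[of 1]
      measurable_cong_sets[OF that refl] by (metis atLeastAtMost_iff order.refl zero_le_one)+
  have T_meas: "T \<in> measurable P borel"
    if "sets P = sets (path_space :: (real \<Rightarrow> real ^ 'd) measure)" for P
    unfolding T_def[abs_def] using eval[OF that] by (rule borel_measurable_Pair)
  note T[measurable] = T_meas[OF sets_P0]
  have rho: "\<rho> = distr P0 borel T"
    unfolding assms(6) endpoint_law_def T_def[abs_def] ..
  interpret rho: prob_space \<rho> unfolding rho by (rule P0.prob_space_distr) simp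
  have marginals: "distr (distr P borel T) borel fst = distr P borel (\<lambda>\<omega>. \<omega> 0)"
    "distr (distr P borel T) borel snd = distr P borel (\<lambda>\<omega>. \<omega> 1)"
    if "sets P = sets (path_space :: (real \<Rightarrow> real ^ 'd) measure)" for P
    using T_meas[OF that] by (subst distr_distr; simp add: comp_def T_def borel_measurable_continuous_onI continuous_on_fst continuous_on_snd)+

  \<comment> \<open>The density of the optimal coupling\<close>
  have pi_coup: "\<pi>' \<in> couplings \<mu>0 \<mu>1" and ac: "absolutely_continuous \<rho> \<pi>'"
    and abs_ln_fin: "(\<integral>\<^sup>+\<omega>. abs_ln (RN_deriv \<rho> \<pi>' (T \<omega>)) \<partial>P0) < \<infinity>"
    and sq_fin: "(\<integral>\<^sup>+\<omega>. (RN_deriv \<rho> \<pi>' (T \<omega>))\<^sup>2 \<partial>P0) < \<infinity>"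
    using assms(8) by (auto simp: couplings2_def assms(6) T_def)
  interpret pi: prob_space \<pi>'
    using pi_coup by (simp add: couplings_def)
  have [measurable]: "RN_deriv \<rho> \<pi>' \<in> borel_measurable borel"
    using borel_measurable_RN_deriv[of \<rho> \<pi>'] by (simp add: rho)
  obtain f where f': "f \<in> borel_measurable \<rho>" and f0: "\<And>x. 0 \<le> f x"
    and RN: "AE x in \<rho>. RN_deriv \<rho> \<pi>' x = ennreal (f x)" and pi_eq: "\<pi>' = density \<rho> (\<lambda>x. ennreal (f x))"
    using rho.ex_real_density[OF pi.prob_space_axioms ac] pi_coup by (auto simp: rho couplings_def)
  have f[measurable]: "f \<in> borel_measurable borel"
    using f' by (simp add: rho)
  have RN_T: "AE \<omega> in P0. RN_deriv \<rho> \<pi>' (T \<omega>) = ennreal (f (T \<omega>))"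
    by (rule AE_distrD[OF T RN[unfolded rho], folded rho])

  \<comment> \<open>The candidate path measure and its admissibility\<close>
  define Q where "Q = density P0 (\<lambda>\<omega>. ennreal (f (T \<omega>)))"
  have Q_eq: "density P0 (\<lambda>\<omega>. RN_deriv \<rho> \<pi>' (\<omega> 0, \<omega> 1)) = Q"
    unfolding Q_def T_def[symmetric] using RN_T by (intro density_cong) auto
  have sets_Q: "sets Q = sets path_space"
    by (simp add: Q_def sets_P0)
  \<comment> \<open>The density factors through \<open>T\<close>, so it can be applied after pushing
    \<open>P0\<close> forward to \<rho>. The total mass of \<open>Q\<close> is then read off from
    \<open>\<pi>'\<close>.\<close>
  have distr_Q: "distr Q borel T = \<pi>'"
    unfolding Q_def pi_eq rho by (rule density_distr[symmetric]) auto
  have prob_Q: "prob_space Q"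
    using pi.prob_space_axioms T_meas[OF sets_Q] unfolding distr_Q[symmetric]
    by (rule prob_space_distrD[rotated])
  have entropy_Q: "rel_entropy Q P0 = rel_entropy \<pi>' \<rho>"
    unfolding Q_def pi_eq rho by (rule P0.rel_entropy_density_comp) (auto simp: f0)
  have RN_Q: "AE \<omega> in P0. RN_deriv P0 Q \<omega> = ennreal (f (T \<omega>))"
    unfolding Q_def by (rule P0.RN_deriv_density) simp

  \<comment> \<open>Since \<open>abs_ln\<close> is infinite at 0, its finite integral forces the
    density to be positive a.e.; this yields \<open>P0 \<lless> Q\<close> below.\<close>
  have "AE \<omega> in P0. abs_ln (RN_deriv \<rho> \<pi>' (T \<omega>)) \<noteq> \<infinity>"
    using abs_ln_fin unfolding abs_ln_def by (intro nn_integral_PInf_AE) auto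
  with RN_T have pos: "AE \<omega> in P0. 0 < f (T \<omega>)"
    by eventually_elim (use f0 in \<open>auto simp: abs_ln_def order.strict_iff_order split: if_splits\<close>)
  have ln_int: "integrable P0 (\<lambda>\<omega>. ln (f (T \<omega>)))"
  proof (rule integrableI_bounded)
    have "(\<integral>\<^sup>+\<omega>. ennreal (norm (ln (f (T \<omega>)))) \<partial>P0) = (\<integral>\<^sup>+\<omega>. abs_ln (RN_deriv \<rho> \<pi>' (T \<omega>)) \<partial>P0)"
      by (rule nn_integral_cong_AE, use RN_T pos in eventually_elim) (auto simp: abs_ln_def)
    with abs_ln_fin show "(\<integral>\<^sup>+\<omega>. ennreal (norm (ln (f (T \<omega>)))) \<partial>P0) < \<infinity>" by simp
  qed simp
  have sq_int: "integrable P0 (\<lambda>\<omega>. (f (T \<omega>))\<^sup>2)"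
  proof (rule integrableI_nonneg)
    have "(\<integral>\<^sup>+\<omega>. ennreal ((f (T \<omega>))\<^sup>2) \<partial>P0) = (\<integral>\<^sup>+\<omega>. (RN_deriv \<rho> \<pi>' (T \<omega>))\<^sup>2 \<partial>P0)"
      by (rule nn_integral_cong_AE, use RN_T in eventually_elim) (simp add: f0 ennreal_power)
    with sq_fin show "(\<integral>\<^sup>+\<omega>. ennreal ((f (T \<omega>))\<^sup>2) \<partial>P0) < \<infinity>" by simp
  qed auto
  have ac_Q: "absolutely_continuous P0 Q"
    unfolding Q_def by (rule absolutely_continuousI_density) simp
  have Q_ac: "absolutely_continuous Q P0"
    unfolding absolutely_continuous_def Q_def
  proof
    fix A assume "A \<in> null_sets (density P0 (\<lambda>\<omega>. ennreal (f (T \<omega>))))"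
    then have A: "A \<in> sets P0" "AE \<omega> in P0. \<omega> \<in> A \<longrightarrow> ennreal (f (T \<omega>)) = 0"
      by (auto simp: null_sets_density_iff)
    from A(2) pos have "AE \<omega> in P0. \<omega> \<notin> A"
      by eventually_elim auto
    with A(1) show "A \<in> null_sets P0"
      by (simp add: AE_iff_null_sets)
  qed
  have "integrable P0 (\<lambda>\<omega>. ln (enn2real (RN_deriv P0 Q \<omega>)))"
    by (rule integrable_cong_AE_imp[OF ln_int]) (use RN_Q in \<open>auto simp: f0\<close>)
  moreover have "integrable P0 (\<lambda>\<omega>. (enn2real (RN_deriv P0 Q \<omega>))\<^sup>2)"
    by (rule integrable_cong_AE_imp[OF sq_int]) (use RN_Q in \<open>auto simp: f0\<close>)
  moreover have "distr Q borel (\<lambda>\<omega>. \<omega> 0) = \<mu>0" "distr Q borel (\<lambda>\<omega>. \<omega> 1) = \<mu>1"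
    using marginals[OF sets_Q] pi_coup by (simp_all add: distr_Q couplings_def)
  ultimately have Q_bridge: "Q \<in> bridge_measures2 P0 \<mu>0 \<mu>1"
    using prob_Q sets_Q ac_Q Q_ac by (simp add: bridge_measures2_def path_measures2_def)

  \<comment> \<open>Comparison of path measures with their endpoint laws\<close>
  have bridge: "distr P borel T \<in> couplings \<mu>0 \<mu>1"
    "rel_entropy (distr P borel T) \<rho> \<le> rel_entropy P P0"
    "rel_entropy (distr P borel T) \<rho> = rel_entropy P P0 \<Longrightarrow>
      density P0 (\<lambda>\<omega>. RN_deriv \<rho> (distr P borel T) (T \<omega>)) = P"
    if "P \<in> bridge_measures2 P0 \<mu>0 \<mu>1" for P
  proof -
    have P: "prob_space P" "absolutely_continuous P0 P" "sets P = sets P0" "sets P = sets path_space"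
      and distr: "distr P borel (\<lambda>\<omega>. \<omega> 0) = \<mu>0" "distr P borel (\<lambda>\<omega>. \<omega> 1) = \<mu>1"
      and sq: "integrable P0 (\<lambda>\<omega>. (enn2real (RN_deriv P0 P \<omega>))\<^sup>2)"
      using that by (simp_all add: bridge_measures2_def path_measures2_def sets_P0)
    show "distr P borel T \<in> couplings \<mu>0 \<mu>1"
      using marginals[OF P(4)] distr prob_space.prob_space_distr[OF P(1) T_meas[OF P(4)]]
      by (simp add: couplings_def)
    show "rel_entropy (distr P borel T) \<rho> \<le> rel_entropy P P0"
      unfolding rho by (rule P0.rel_entropy_distr(1)[OF P(1-3) T])
    obtain g where g[measurable]: "g \<in> borel_measurable P0" and g0: "\<And>x. 0 \<le> g x"
      and RN_g: "AE x in P0. RN_deriv P0 P x = ennreal (g x)"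
      and P_eq: "P = density P0 (\<lambda>x. ennreal (g x))"
      using P0.ex_real_density[OF P(1-3)] by blast
    have "integrable P0 (\<lambda>\<omega>. (g \<omega>)\<^sup>2)"
      by (rule integrable_cong_AE_imp[OF sq]) (use RN_g in \<open>auto simp: g0\<close>)
    \<comment> \<open>Finiteness gives access to the equality case of the data-processing
      inequality.\<close>
    then have "rel_entropy P P0 < \<infinity>"
      unfolding P_eq by (intro P0.rel_entropy_finite_of_square_integrable) (auto simp: g0)
    then show "rel_entropy (distr P borel T) \<rho> = rel_entropy P P0 \<Longrightarrow>
      density P0 (\<lambda>\<omega>. RN_deriv \<rho> (distr P borel T) (T \<omega>)) = P"
      unfolding rho by (rule P0.rel_entropy_distr(2)[OF P(1-3) T])
  qed
  have pi_min: "rel_entropy \<pi>' \<rho> \<le> rel_entropy \<pi> \<rho>" if "\<pi> \<in> couplings \<mu>0 \<mu>1" for \<pi>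
    using assms(7) that by (auto simp: unique_minimizer_def is_arg_min_def not_less)
  \<comment> \<open>A coupling whose entropy does not exceed the minimum is itself a minimizer,
    hence equals \<open>\<pi>'\<close>.\<close>
  have pi_unique: "\<pi> = \<pi>'" if "\<pi> \<in> couplings \<mu>0 \<mu>1" "rel_entropy \<pi> \<rho> \<le> rel_entropy \<pi>' \<rho>" for \<pi>
  proof -
    have "is_arg_min (\<lambda>\<pi>. rel_entropy \<pi> \<rho>) (\<lambda>\<pi>. \<pi> \<in> couplings \<mu>0 \<mu>1) \<pi>"
      unfolding is_arg_min_def using that pi_min by (meson leD order.trans)
    with assms(7) show ?thesis
      unfolding unique_minimizer_def by blast
  qed

  \<comment> \<open>Minimality and uniqueness on path space\<close>
  show ?thesis
    unfolding Q_eq unique_minimizer_def is_arg_min_def not_less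
  proof (intro conjI allI impI notI)
    show "Q \<in> bridge_measures2 P0 \<mu>0 \<mu>1" by fact
  next
    assume "\<exists>P. P \<in> bridge_measures2 P0 \<mu>0 \<mu>1 \<and> rel_entropy P P0 < rel_entropy Q P0"
    then obtain P where P: "P \<in> bridge_measures2 P0 \<mu>0 \<mu>1" "rel_entropy P P0 < rel_entropy \<pi>' \<rho>"
      by (auto simp: entropy_Q)
    \<comment> \<open>The entropy of the endpoint law of \<open>P\<close> lies between those of
      \<open>\<pi>'\<close> and \<open>P\<close>, against the assumed strict inequality.\<close>
    with bridge(2)[OF P(1)] pi_min[OF bridge(1)[OF P(1)]] show False by simp
  next
    fix P assume P: "P \<in> bridge_measures2 P0 \<mu>0 \<mu>1 \<and>
      (\<nexists>P'. P' \<in> bridge_measures2 P0 \<mu>0 \<mu>1 \<and> rel_entropy P' P0 < rel_entropy P P0)"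
    \<comment> \<open>The minimizer \<open>P\<close> is compared with \<open>Q\<close>, whose
      entropy is that of \<open>\<pi>'\<close>.\<close>
    with Q_bridge have le: "rel_entropy P P0 \<le> rel_entropy \<pi>' \<rho>"
      unfolding entropy_Q[symmetric] by (meson not_less)
    have eq: "distr P borel T = \<pi>'"
      using P bridge(1,2)[of P] le by (intro pi_unique) auto
    \<comment> \<open>With endpoint law \<open>\<pi>'\<close>, the data-processing inequality and
      \<open>le\<close> give equal entropies, and the equality case recovers \<open>P\<close> from
      \<open>\<pi>'\<close>.\<close>
    have "density P0 (\<lambda>\<omega>. RN_deriv \<rho> \<pi>' (T \<omega>)) = P"
      using P bridge(2,3)[of P] le unfolding eq by auto
    then show "P = Q"
      using Q_eq by (simp add: T_def)
  qed
qed

end
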